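(* For every odd integer $n\ge 3$, $\gamma_I(C_2 \square C_n) = n+1$.
   Context: For an integer $k\ge 2$, $C_k$ denotes the directed cycle with vertex set $\{1,2,\dots,k\}$ and arcs $i\rightarrow i+1$ (indices taken modulo $k$); in particular $C_2$ has arcs $1\rightarrow 2$ and $2\rightarrow 1$. For digraphs $D_1=(V_1,A_1)$ and $D_2=(V_2,A_2)$, the cartesian product $D_1\square D_2$ is the digraph with vertex set $V_1\times V_2$ in which $(x_1,x_2)\rightarrow(y_1,y_2)$ is an arc if and only if either ($x_1=y_1$ and $x_2\rightarrow y_2$ in $D_2$) or ($x_1\rightarrow y_1$ in $D_1$ and $x_2=y_2$). An Italian dominating function on a digraph $D$ is a function $f:V(D)\to\{0,1,2\}$ such that every vertex $v$ with $f(v)=0$ has at least two in-neighbors $u$ with $f(u)=1$ or at least one in-neighbor $w$ with $f(w)=2$ (an in-neighbor of $v$ is a vertex $u$ with $u\rightarrow v$). Its weight is $\sum_{u\in V(D)} f(u)$, and the Italian domination number $\gamma_I(D)$ is the minimum weight of an Italian dominating function on $D$. *)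

theory Defs
  imports "Graph_Theory.Graph_Theory"
begin

text \<open>The successor of \<open>i\<close> in \<open>{1..k}\<close> modulo \<open>k\<close> is \<open>i mod k + 1\<close>; in particular \<open>k\<close> is mapped to \<open>1\<close>.\<close>

definition dicycle :: "nat \<Rightarrow> nat pair_pre_digraph" where
  "dicycle k = \<lparr> pverts = {1..k}, parcs = {(i, i mod k + 1) | i. i \<in> {1..k}} \<rparr>"

definition cart_prod :: "'a pair_pre_digraph \<Rightarrow> 'b pair_pre_digraph \<Rightarrow> ('a \<times> 'b) pair_pre_digraph"
    (infixr \<open>\<box>\<close> 70) where
  "D1 \<box> D2 = \<lparr> pverts = pverts D1 \<times> pverts D2,
     parcs = {((x1, x2), (y1, y2)) | x1 x2 y1 y2.
       (x1, x2) \<in> pverts D1 \<times> pverts D2 \<and> (y1, y2) \<in> pverts D1 \<times> pverts D2 \<and>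
       ((x1 = y1 \<and> (x2, y2) \<in> parcs D2) \<or> ((x1, y1) \<in> parcs D1 \<and> x2 = y2))} \<rparr>"

definition in_neighbors :: "'a pair_pre_digraph \<Rightarrow> 'a \<Rightarrow> 'a set" where
  "in_neighbors D v = {u \<in> pverts D. (u, v) \<in> parcs D}"

text \<open>Functions on the vertex set are total functions whose values outside the vertex set are
  irrelevant. The definitions below are meant for finite digraphs.\<close>

definition italian_dominating :: "'a pair_pre_digraph \<Rightarrow> ('a \<Rightarrow> nat) \<Rightarrow> bool" where
  "italian_dominating D f \<longleftrightarrow>
     (\<forall>v \<in> pverts D. f v \<in> {0, 1, 2}) \<and>
     (\<forall>v \<in> pverts D. f v = 0 \<longrightarrow>
        card {u \<in> in_neighbors D v. f u = 1} \<ge> 2 \<or> (\<exists>w \<in> in_neighbors D v. f w = 2))"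

definition weight :: "'a pair_pre_digraph \<Rightarrow> ('a \<Rightarrow> nat) \<Rightarrow> nat" where
  "weight D f = (\<Sum>u \<in> pverts D. f u)"

definition italian_domination_number :: "'a pair_pre_digraph \<Rightarrow> nat" (\<open>\<gamma>\<^sub>I\<close>) where
  "\<gamma>\<^sub>I D = (LEAST w. \<exists>f. italian_dominating D f \<and> weight D f = w)"

lemma italian_domination_number_attained:
  "\<exists>f. italian_dominating D f \<and> weight D f = \<gamma>\<^sub>I D"
proof -
  have "italian_dominating D (\<lambda>_. 1)"
    by (simp add: italian_dominating_def)
  then have "\<exists>f. italian_dominating D f \<and> weight D f = weight D (\<lambda>_. 1)"
    by blast
  then show ?thesis
    unfolding italian_domination_number_def by (rule LeastI)
qed

lemma italian_domination_number_le:
  "italian_dominating D f \<Longrightarrow> \<gamma>\<^sub>I D \<le> weight D f"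
  unfolding italian_domination_number_def by (rule Least_le) blast

lemma pair_digraph_dicycle:
  assumes "k \<ge> 2"
  shows "pair_digraph (dicycle k)"
proof
  fix e assume "e \<in> parcs (dicycle k)"
  then obtain i where i: "e = (i, i mod k + 1)" "1 \<le> i" "i \<le> k"
    by (auto simp: dicycle_def)
  have "Suc (i mod k) \<le> k" using assms by (simp add: Suc_le_eq)
  then show "fst e \<in> pverts (dicycle k)" "snd e \<in> pverts (dicycle k)"
    using i by (auto simp: dicycle_def)
  show "fst e \<noteq> snd e"
    using i assms by (cases "i = k") auto
next
  show "finite (pverts (dicycle k))" by (simp add: dicycle_def)
  have "parcs (dicycle k) = (\<lambda>i. (i, i mod k + 1)) ` {1..k}"
    by (auto simp: dicycle_def)
  then show "finite (parcs (dicycle k))" by simp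
qed

lemma pair_digraph_cart_prod:
  assumes "pair_digraph D1" "pair_digraph D2"
  shows "pair_digraph (D1 \<box> D2)"
proof -
  interpret D1: pair_digraph D1 by fact
  interpret D2: pair_digraph D2 by fact
  show ?thesis
  proof
    fix e assume "e \<in> parcs (D1 \<box> D2)"
    then show "fst e \<in> pverts (D1 \<box> D2)" "snd e \<in> pverts (D1 \<box> D2)" "fst e \<noteq> snd e"
      using D1.pair_no_loops D2.pair_no_loops by (auto simp: cart_prod_def)
  next
    show fin: "finite (pverts (D1 \<box> D2))"
      by (simp add: cart_prod_def D1.pair_finite_verts D2.pair_finite_verts)
    have "parcs (D1 \<box> D2) \<subseteq> pverts (D1 \<box> D2) \<times> pverts (D1 \<box> D2)"
      by (auto simp: cart_prod_def)
    then show "finite (parcs (D1 \<box> D2))"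
      using fin by (meson finite_SigmaI finite_subset)
  qed
qed

end

theory Submission
  imports Defs
begin

text \<open>
  Columns of \<open>C\<^sub>2 \<box> C\<^sub>n\<close> are indexed by \<open>i mod n + 1\<close> with \<open>i\<close> an arbitrary natural number. Every
  vertex has exactly two in-neighbours, so a vertex of value \<open>0\<close> is dominated iff the values of
  these two add up to at least \<open>2\<close>. It follows that two consecutive columns have total weight at
  least \<open>2\<close>, and summing around the cycle bounds the weight below by \<open>n\<close>. If the weight were
  \<open>n\<close>, every column would have weight exactly \<open>1\<close>, with the \<open>1\<close> alternating between the two rows,
  which is impossible for odd \<open>n\<close>. A column \<open>(1,1)\<close> followed by alternating columns attains \<open>n + 1\<close>.
\<close>

lemma pverts_prod: "pverts (dicycle 2 \<box> dicycle n) = {1, 2} \<times> {1..n}"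
  by (auto simp: cart_prod_def dicycle_def)

lemma Suc_mod_in_range: "n > 0 \<Longrightarrow> Suc (i mod n) \<in> {1..n}"
  by (simp add: Suc_le_eq)

text \<open>Once a column is written in this form, its predecessor is \<open>Suc (i mod n)\<close>,
  so the wrap-around from column \<open>n\<close> to column 1 needs no case of its own.\<close>

lemma ex_column:
  assumes "n > 0" "j \<in> {1..n}"
  obtains i where "j = Suc (Suc i mod n)"
proof
  \<comment> \<open>Adding \<open>n\<close> keeps \<open>j - 2\<close> from being truncated at
    \<open>j = 1\<close>.\<close>
  have "Suc (j + n - 2) = (j - 1) + n" using assms by auto
  then have "Suc (j + n - 2) mod n = (j - 1) mod n" by (simp only: mod_add_self2)
  then show "j = Suc (Suc (j + n - 2) mod n)" using assms by auto
qed

lemma dicycle_arc_iff: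
  assumes "n > 0"
  shows "(x, Suc (Suc i mod n)) \<in> parcs (dicycle n) \<longleftrightarrow> x = Suc (i mod n)"
proof
  assume "(x, Suc (Suc i mod n)) \<in> parcs (dicycle n)"
  then have x: "x mod n = Suc i mod n" "x \<in> {1..n}"
    by (auto simp: dicycle_def)
  then obtain y where y: "x = Suc y" "y < n" by (cases x) auto
  have "y mod n = i mod n"
    using x(1) y(1) by (auto simp: mod_Suc split: if_splits)
  then show "x = Suc (i mod n)" using y by simp
next
  assume "x = Suc (i mod n)"
  then show "(x, Suc (Suc i mod n)) \<in> parcs (dicycle n)"
    using Suc_mod_in_range[OF assms, of i] by (auto simp: dicycle_def mod_Suc_eq)
qed

lemma dicycle_2_arc_iff:
  assumes "r \<in> {1, 2}"
  shows "(x, r) \<in> parcs (dicycle 2) \<longleftrightarrow> x = 3 - r"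
proof -
  have "{1..2::nat} = {1, 2}" by auto
  then have "parcs (dicycle 2) = {(1, 2), (2, 1)}" by (auto simp: dicycle_def)
  moreover have "r = 1 \<or> r = 2" using assms by simp
  ultimately show ?thesis by (elim disjE) simp_all
qed

lemma in_neighbors_prod:
  assumes "n > 0" "r \<in> {1, 2}"
  shows "in_neighbors (dicycle 2 \<box> dicycle n) (r, Suc (Suc i mod n)) =
    {(3 - r, Suc (Suc i mod n)), (r, Suc (i mod n))}"
proof -
  have "(u, v) \<in> in_neighbors (dicycle 2 \<box> dicycle n) (r, Suc (Suc i mod n)) \<longleftrightarrow>
    (u, v) \<in> {1, 2} \<times> {1..n} \<and>
      (u = r \<and> v = Suc (i mod n) \<or> u = 3 - r \<and> v = Suc (Suc i mod n))" for u v
    using assms dicycle_arc_iff[OF assms(1), of v i] dicycle_2_arc_iff[OF assms(2), of u]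
      Suc_mod_in_range[OF assms(1), of "Suc i"] pverts_prod[of n]
    by (auto simp: in_neighbors_def cart_prod_def)
  moreover have "3 - r \<in> {1, 2}" using assms by auto
  ultimately show ?thesis
    using assms Suc_mod_in_range[OF assms(1)] by auto
qed

text \<open>Two values of at most 2 reach the sum 2 only as 1 + 1 or with a 2 among them. Domination
  thus becomes a linear condition.\<close>

lemma two_in_neighbors_dominated_iff:
  fixes f :: "'a \<Rightarrow> nat"
  assumes "p \<noteq> q" "f p \<le> 2" "f q \<le> 2"
  shows "card {u \<in> {p, q}. f u = 1} \<ge> 2 \<or> (\<exists>w \<in> {p, q}. f w = 2) \<longleftrightarrow> f p + f q \<ge> 2"
proof -
  have eq: "{u \<in> {p, q}. f u = 1} = (if f p = 1 then {p} else {}) \<union> (if f q = 1 then {q} else {})"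
    by auto
  have card: "card {u \<in> {p, q}. f u = 1} = (if f p = 1 then 1 else 0) + (if f q = 1 then 1 else 0)"
    unfolding eq using assms(1) by simp
  have "f p = 0 \<or> f p = 1 \<or> f p = 2" "f q = 0 \<or> f q = 1 \<or> f q = 2"
    using assms by linarith+
  then show ?thesis unfolding card by (elim disjE) simp_all
qed

lemma italian_dominating_prod_iff:
  assumes "n > 0"
  shows "italian_dominating (dicycle 2 \<box> dicycle n) f \<longleftrightarrow>
    (\<forall>r \<in> {1, 2}. \<forall>i. f (r, Suc (Suc i mod n)) \<le> 2) \<and>
    (\<forall>r \<in> {1, 2}. \<forall>i. f (r, Suc (Suc i mod n)) = 0 \<longrightarrow>
       f (3 - r, Suc (Suc i mod n)) + f (r, Suc (i mod n)) \<ge> 2)"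
    (is "?D \<longleftrightarrow> ?L \<and> ?S")
proof -
  let ?G = "dicycle 2 \<box> dicycle n"
  have all: "(\<forall>v \<in> pverts ?G. P v) \<longleftrightarrow> (\<forall>r \<in> {1, 2}. \<forall>i. P (r, Suc (Suc i mod n)))"
    for P :: "nat \<times> nat \<Rightarrow> bool"
  proof (intro iffI ballI allI)
    fix v assume "\<forall>r \<in> {1, 2}. \<forall>i. P (r, Suc (Suc i mod n))" "v \<in> pverts ?G"
    then show "P v"
      unfolding pverts_prod by (elim SigmaE ex_column[OF assms]) blast
  next
    fix r :: nat and i assume "\<forall>v \<in> pverts ?G. P v" "r \<in> {1, 2}"
    then show "P (r, Suc (Suc i mod n))"
      using Suc_mod_in_range[OF assms, of "Suc i"] unfolding pverts_prod by blast
  qed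
  have le: "(\<forall>v \<in> pverts ?G. f v \<in> {0, 1, 2}) \<longleftrightarrow> ?L"
  proof -
    have "k \<in> {0, 1, 2} \<longleftrightarrow> k \<le> 2" for k :: nat by auto
    then show ?thesis unfolding all by (simp only:)
  qed
  show ?thesis
  proof (cases ?L)
    case True
    then have bound: "f v \<le> 2" if "v \<in> pverts ?G" for v
      using that le by force
    have "card {u \<in> in_neighbors ?G (r, Suc (Suc i mod n)). f u = 1} \<ge> 2 \<or>
        (\<exists>w \<in> in_neighbors ?G (r, Suc (Suc i mod n)). f w = 2) \<longleftrightarrow>
        f (3 - r, Suc (Suc i mod n)) + f (r, Suc (i mod n)) \<ge> 2" if r: "r \<in> {1, 2}" for r i
      unfolding in_neighbors_prod[OF assms r]
    proof (rule two_in_neighbors_dominated_iff)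
      show "(3 - r, Suc (Suc i mod n)) \<noteq> (r, Suc (i mod n))" using r by auto
      have "3 - r \<in> {1, 2}" using r by auto
      then show "f (3 - r, Suc (Suc i mod n)) \<le> 2" "f (r, Suc (i mod n)) \<le> 2"
        using r Suc_mod_in_range[OF assms] by (auto simp only: pverts_prod intro!: bound)
    qed
    then show ?thesis
      unfolding italian_dominating_def le unfolding all by (simp add: True)
  next
    case False
    then show ?thesis unfolding italian_dominating_def le by blast
  qed
qed

lemma weight_prod:
  "weight (dicycle 2 \<box> dicycle n) f = (\<Sum>i<n. f (1, Suc i) + f (2, Suc i))"
proof -
  have "weight (dicycle 2 \<box> dicycle n) f = (\<Sum>r \<in> {1, 2}. \<Sum>j \<in> {1..n}. f (r, j))"
    by (simp add: weight_def pverts_prod sum.cartesian_product)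
  also have "\<dots> = (\<Sum>j \<in> {1..n}. f (1, j)) + (\<Sum>j \<in> {1..n}. f (2, j))"
    by simp
  also have "\<dots> = (\<Sum>i<n. f (1, Suc i)) + (\<Sum>i<n. f (2, Suc i))"
    by (simp add: sum.atLeast1_atMost_eq)
  finally show ?thesis by (simp add: sum.distrib)
qed

lemma weight_lower_bound:
  assumes "odd n" and f: "italian_dominating (dicycle 2 \<box> dicycle n) f"
  shows "weight (dicycle 2 \<box> dicycle n) f \<ge> n + 1"
proof (rule ccontr)
  assume less: "\<not> weight (dicycle 2 \<box> dicycle n) f \<ge> n + 1"
  have n: "n > 0" using assms(1) by (rule odd_pos)
  define a b where "a i = f (1, Suc (i mod n))" and "b i = f (2, Suc (i mod n))" for i
  have a: "a (Suc i) = 0 \<Longrightarrow> b (Suc i) + a i \<ge> 2"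
    and b: "b (Suc i) = 0 \<Longrightarrow> a (Suc i) + b i \<ge> 2" for i
    using f[unfolded italian_dominating_prod_iff[OF n]] by (auto simp: a_def b_def)
  define w where "w i = a i + b i" for i
  have period: "a n = a 0" "w n = w 0" by (simp_all add: w_def a_def b_def)
  \<comment> \<open>A column without a 0 has weight at least 2 by itself; a 0 in it forces its other
    entry and an entry of the previous column to add up to at least 2.\<close>
  have pair: "w i + w (Suc i) \<ge> 2" for i
    using a[of i] b[of i] unfolding w_def by linarith
  have weight: "weight (dicycle 2 \<box> dicycle n) f = (\<Sum>i<n. w i)"
    unfolding weight_prod by (rule sum.cong) (auto simp: w_def a_def b_def)
  have "(\<Sum>i<n. w (Suc i)) = (\<Sum>i<n. w i)"
    using sum.lessThan_Suc_shift[of w n] period by simp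
  \<comment> \<open>The weight is at most \<open>n\<close> by \<open>less\<close>, and this sum
    counts every column twice.\<close>
  then have "(\<Sum>i<n. w i + w (Suc i)) \<le> (\<Sum>i<n. 2)"
    using less weight by (simp add: sum.distrib)
  moreover have "(\<Sum>i<n. 2) \<le> (\<Sum>i<n. w i + w (Suc i))"
    by (rule sum_mono) (rule pair)
  ultimately have "(\<Sum>i<n. 2) = (\<Sum>i<n. w i + w (Suc i))" by (rule le_antisym[rotated])
  then have tight: "w i + w (Suc i) = 2" if "i < n" for i
    using sum_mono_inv[of "\<lambda>_. 2" "{..<n}" "\<lambda>i. w i + w (Suc i)" i] pair that by simp
  \<comment> \<open>Zeros in both rows at \<open>Suc i\<close> would force \<open>w i\<close> to be
    at least 4, against \<open>tight\<close>.\<close>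
  have pos: "w (Suc i) > 0" if "i < n" for i
    using a[of i] b[of i] tight[OF that] unfolding w_def by linarith
  have "w 0 > 0" using pos[of "n - 1"] n period by simp
  then have "w i > 0" if "i < n" for i
    using pos[of "i - 1"] that by (cases i) auto
  then have one: "w i = 1 \<and> w (Suc i) = 1" if "i < n" for i
    using tight[of i] pos[of i] that by fastforce
  \<comment> \<open>The row that is 0 at \<open>Suc i\<close> finds only a 1 in the other row, so it
    must hold the 1 at \<open>i\<close>.\<close>
  have flip: "a i + a (Suc i) = 1" if "i < n" for i
    using a[of i] b[of i] one[OF that] unfolding w_def by linarith
  have "a i = (if even i then a 0 else 1 - a 0)" if "i \<le> n" for i
    using that
  proof (induction i)
    case (Suc i)
    then show ?case using flip[of i] flip[of 0] n by auto
  qed simp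
  \<comment> \<open>An odd number of flips ends at \<open>1 - a 0\<close>, while going once around
    returns to \<open>a 0\<close>. No natural number satisfies this equation, even with truncated
    subtraction.\<close>
  from this[of n] have "a 0 = 1 - a 0" using assms(1) period by simp
  then show False by presburger
qed

lemma exists_italian_dominating_weight:
  assumes "odd n"
  shows "\<exists>f. italian_dominating (dicycle 2 \<box> dicycle n) f \<and> weight (dicycle 2 \<box> dicycle n) f = n + 1"
proof -
  have n: "n > 0" using assms by (rule odd_pos)
  \<comment> \<open>As \<open>n\<close> is odd, alternation breaks only between columns
    \<open>n\<close> and 1, and a column 1 full of ones has nothing to dominate. A 0 in a later
    column sees a 1 in the other row and a 1 before it in its own row.\<close>
  define f :: "nat \<times> nat \<Rightarrow> nat"
    where "f = (\<lambda>(r, j). if j = 1 \<or> (odd j \<longleftrightarrow> r = 1) then 1 else 0)"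
  have "italian_dominating (dicycle 2 \<box> dicycle n) f"
    unfolding italian_dominating_prod_iff[OF n]
    by (auto simp: f_def mod_Suc)
  \<comment> \<open>Column 1 contributes 2 and each later column 1, so only the empty sum is
    exceptional.\<close>
  moreover have "(\<Sum>i<m. f (1, Suc i) + f (2, Suc i)) = (if m = 0 then 0 else m + 1)" for m
    by (induction m) (auto simp: f_def)
  ultimately show ?thesis using weight_prod n by auto
qed

theorem theorem2p2:
  fixes n :: nat
  assumes "odd n" and "n \<ge> 3"
  shows "\<gamma>\<^sub>I (dicycle 2 \<box> dicycle n) = n + 1"
proof (rule antisym)
  show "\<gamma>\<^sub>I (dicycle 2 \<box> dicycle n) \<le> n + 1"
    using exists_italian_dominating_weight[OF assms(1)] italian_domination_number_le by fastforce
  obtain f where f: "italian_dominating (dicycle 2 \<box> dicycle n) f"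
    "weight (dicycle 2 \<box> dicycle n) f = \<gamma>\<^sub>I (dicycle 2 \<box> dicycle n)"
    using italian_domination_number_attained by blast
  show "n + 1 \<le> \<gamma>\<^sub>I (dicycle 2 \<box> dicycle n)"
    using weight_lower_bound[OF assms(1) f(1)] unfolding f(2) .
qed

end
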